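(* There is an absolute constant $C>0$ such that for all sufficiently large $n$, every edge-ordering of the complete graph $K_n$ contains a monotone path of length at least $$\frac{n}{2^{C\sqrt{\log n\,\log\log n}}}.$$ In other words, $f(K_n)\ge n/2^{O(\sqrt{\log n\log\log n})}=n^{1-o(1)}$.
   Context: An edge-ordering of a graph $G$ is a total order $\le_G$ on $E(G)$. A path is monotone if its consecutive edges form a monotone sequence with respect to $\le_G$. The altitude $f(G)$ is the maximum $k$ such that every edge-ordering of $G$ has a monotone path of length $k$ (length = number of edges). All logarithms are base 2. *)

theory Defs
  imports "HOL-Analysis.Analysis"
begin

definition Kn_edges :: "nat \<Rightarrow> nat set set" where
  "Kn_edges n = {{u, v} | u v. u < n \<and> v < n \<and> u \<noteq> v}"

definition edge_ordering :: "nat \<Rightarrow> nat set rel \<Rightarrow> bool" where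
  "edge_ordering n R \<longleftrightarrow> linear_order_on (Kn_edges n) R"

definition path_edges :: "nat list \<Rightarrow> nat set list" where
  "path_edges vs = map (\<lambda>(u, v). {u, v}) (zip vs (tl vs))"

definition Kn_path :: "nat \<Rightarrow> nat list \<Rightarrow> bool" where
  "Kn_path n vs \<longleftrightarrow> vs \<noteq> [] \<and> distinct vs \<and> set vs \<subseteq> {..<n}"

definition monotone_path :: "nat set rel \<Rightarrow> nat list \<Rightarrow> bool" where
  "monotone_path R vs \<longleftrightarrow>
     (let es = path_edges vs in
       (\<forall>i. Suc i < length es \<longrightarrow> (es ! i, es ! Suc i) \<in> R) \<or>
       (\<forall>i. Suc i < length es \<longrightarrow> (es ! Suc i, es ! i) \<in> R))"

end

theory Submission
  imports Defs
begin

text \<open>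
  Call a vertex \<open>v\<close> good for \<open>(x, l)\<close> if every set of at most \<open>x\<close> vertices other than \<open>v\<close> is avoided
  by some increasing path of length \<open>l\<close> from \<open>v\<close>. Two facts are played against each other, where
  \<open>h\<close> is about \<open>log n\<close>.

  (1) If average degree \<open>d\<close> forces an increasing path of length \<open>h * l + 1\<close>, then average degree
  \<open>9 * h * d\<close> forces a vertex that is good for \<open>(d, l)\<close>. Peel off the last \<open>4 * d\<close> edges at every
  vertex, \<open>h\<close> times over; start at a vertex that still has an edge and explore outside the forbidden
  set, using one peeled layer per step. The explored set cannot double at every step, so at some step
  the explored edges have average degree at least \<open>d\<close>, hence contain a long path. The walk that leads
  to this path has at most \<open>h\<close> vertices and thus leaves one of its stretches of length \<open>l\<close> untouched.

  (2) If average degree \<open>m\<close> forces a vertex that is good for \<open>(x, l)\<close>, then average degree about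
  \<open>s * (m + 2 * x)\<close> forces an increasing path of length \<open>s * l\<close>, provided \<open>s * l \<le> x\<close>. Run time
  backwards and sort the vertices into \<open>s\<close> classes, by the number of multiples of \<open>l\<close> that they can
  robustly continue. A vertex meets at most \<open>x\<close> edges into higher classes before it moves up itself,
  and the edges inside one class have average degree below \<open>m\<close>, as otherwise a vertex that is good
  for \<open>(x, l)\<close> in this class would have moved up.

  Alternating (1) and (2) about \<open>sqrt (log n / log log n)\<close> times, with \<open>s\<close> about
  \<open>2 powr sqrt (log n * log log n)\<close>, loses a power of \<open>log n\<close> in each round.
\<close>

subsection \<open>Finite relations and lists\<close>

lemma card_rel_le:
  assumes "finite V" "F \<subseteq> V \<times> V" "\<And>v. v \<in> V \<Longrightarrow> card (F `` {v}) \<le> k"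
  shows "card F \<le> k * card V"
proof -
  have F: "F = (SIGMA v:V. F `` {v})" using assms(2) by auto
  have fin: "\<forall>v\<in>V. finite (F `` {v})"
    by (intro ballI finite_subset[OF _ assms(1)]) (use assms(2) in auto)
  have "card F = (\<Sum>v\<in>V. card (F `` {v}))"
    by (subst F, rule card_SigmaI) (use assms(1) fin in auto)
  also have "\<dots> \<le> (\<Sum>v\<in>V. k)" by (intro sum_mono assms(3))
  finally show ?thesis by (simp add: mult.commute)
qed

lemma card_rel_ge:
  assumes "finite F" "\<And>v. v \<in> A \<Longrightarrow> k \<le> card (F `` {v})" "finite A"
  shows "k * card A \<le> card F"
proof -
  have fin: "finite (F `` {v})" for v using assms(1) by (simp add: finite_Image)
  have "k * card A = (\<Sum>v\<in>A. k)" by simp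
  also have "\<dots> \<le> (\<Sum>v\<in>A. card (F `` {v}))" by (intro sum_mono assms(2))
  also have "\<dots> = card (SIGMA v:A. F `` {v})" using assms(3) fin by simp
  also have "\<dots> \<le> card F" by (intro card_mono assms(1)) auto
  finally show ?thesis .
qed

text \<open>Cut \<open>q\<close> before each member of \<open>S\<close>. This gives at most
  \<open>h\<close> stretches with more than \<open>h * l\<close> entries together, so one stretch
  has more than \<open>l\<close>. The induction on \<open>h\<close> removes the first
  stretch.\<close>

lemma list_gap:
  assumes "q \<noteq> []" "hd q \<in> S" "distinct q" "card (S \<inter> set q) \<le> h" "h * l < length q"
  shows "\<exists>xs w f ys. q = xs @ w # f @ ys \<and> w \<in> S \<and> set f \<inter> S = {} \<and> length f = l"
  using assms
proof (induction h arbitrary: q)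
  case 0
  then have "S \<inter> set q = {}" by simp
  then show ?case using 0 by (metis disjoint_iff hd_in_set)
next
  case (Suc h)
  obtain w q' where q: "q = w # q'" using Suc.prems(1) by (cases q) auto
  define f where "f = takeWhile (\<lambda>z. z \<notin> S) q'"
  define r where "r = dropWhile (\<lambda>z. z \<notin> S) q'"
  have q': "q' = f @ r" by (simp add: f_def r_def)
  have f: "set f \<inter> S = {}" by (auto simp: f_def dest: set_takeWhileD)
  show ?case
  proof (cases "l \<le> length f")
    case True
    have "q = [] @ w # take l f @ (drop l f @ r)" using q q' by (simp flip: append_assoc)
    moreover have "set (take l f) \<inter> S = {}" using f set_take_subset by fastforce
    ultimately show ?thesis using True Suc.prems(2) q by (metis length_take list.sel(1) min.absorb2)
  next
    case False
    then have len: "h * l < length r" using Suc.prems(5) q q' by auto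
    then have r: "r \<noteq> []" by auto
    have hd: "hd r \<in> S" using hd_dropWhile[of "\<lambda>z. z \<notin> S" q'] r by (auto simp: r_def)
    have "S \<inter> set r \<subseteq> S \<inter> set q - {w}" using Suc.prems(3) q q' by auto
    then have "card (S \<inter> set r) \<le> card (S \<inter> set q - {w})" by (intro card_mono) auto
    also have "\<dots> = card (S \<inter> set q) - 1"
      using Suc.prems(2) q by (intro card_Diff_singleton) auto
    also have "\<dots> \<le> h" using Suc.prems(4) by simp
    finally obtain xs w' f' ys where *: "r = xs @ w' # f' @ ys" "w' \<in> S" "set f' \<inter> S = {}" "length f' = l"
      using Suc.IH[OF r hd] Suc.prems(3) q q' len by auto
    have "q = (w # f @ xs) @ w' # f' @ ys" using q q' * by simp
    then show ?thesis using * by blast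
  qed
qed

subsection \<open>Increasing walks and paths\<close>

locale timed_edges =
  fixes T :: "'a \<Rightarrow> 'a \<Rightarrow> nat"
  assumes T_commute: "T u v = T v u"
begin

text \<open>The last condition makes \<open>T\<close> a proper edge-colouring; it is inherited by
  the symmetric subsets of \<open>E\<close> to which the forcing statements are applied.\<close>

definition timed_graph :: "'a set \<Rightarrow> ('a \<times> 'a) set \<Rightarrow> bool" where
  "timed_graph V E \<longleftrightarrow> finite V \<and> E \<subseteq> V \<times> V \<and> sym E \<and> irrefl E \<and>
     (\<forall>u v w. (u, v) \<in> E \<longrightarrow> (u, w) \<in> E \<longrightarrow> T u v = T u w \<longrightarrow> v = w)"

text \<open>All edge times of the walk lie in the half-open interval from \<open>t\<close> to \<open>b\<close>.\<close>

fun inc_walk :: "('a \<times> 'a) set \<Rightarrow> nat \<Rightarrow> 'a list \<Rightarrow> nat \<Rightarrow> bool" where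
  "inc_walk E t [] b = False"
| "inc_walk E t [v] b = (t \<le> b)"
| "inc_walk E t (u # v # vs) b =
     ((u, v) \<in> E \<and> t \<le> T u v \<and> inc_walk E (Suc (T u v)) (v # vs) b)"

definition inc_path :: "('a \<times> 'a) set \<Rightarrow> nat \<Rightarrow> 'a \<Rightarrow> nat \<Rightarrow> 'a set \<Rightarrow> bool" where
  "inc_path E t v l X \<longleftrightarrow> (\<exists>vs b. inc_walk E t vs b \<and> distinct vs \<and> hd vs = v \<and>
     length vs = Suc l \<and> set vs \<inter> X = {})"

text \<open>Edges are ordered pairs, so \<open>d * card V \<le> card E\<close> says that the average degree is at least \<open>d\<close>.\<close>

definition forces :: "nat \<Rightarrow> nat \<Rightarrow> nat \<Rightarrow> nat \<Rightarrow> bool" where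
  "forces N d x l \<longleftrightarrow> (\<forall>V E. timed_graph V E \<longrightarrow> V \<noteq> {} \<longrightarrow> card V \<le> N \<longrightarrow> d * card V \<le> card E \<longrightarrow>
     (\<exists>v\<in>V. \<forall>X. finite X \<longrightarrow> card X \<le> x \<longrightarrow> v \<notin> X \<longrightarrow> inc_path E 0 v l X))"

lemma inc_walk_weaken:
  "inc_walk E t vs b \<Longrightarrow> t' \<le> t \<Longrightarrow> b \<le> b' \<Longrightarrow> E \<subseteq> E' \<Longrightarrow> inc_walk E' t' vs b'"
  by (induction E t vs b arbitrary: t' rule: inc_walk.induct) auto

lemma inc_walk_le: "inc_walk E t vs b \<Longrightarrow> t \<le> b"
  by (induction E t vs b rule: inc_walk.induct) auto

lemma inc_walk_append:
  "inc_walk E t (p @ [w]) a \<Longrightarrow> inc_walk E a (w # q) b \<Longrightarrow> inc_walk E t (p @ w # q) b"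
proof (induction p arbitrary: t)
  case Nil
  then show ?case by (auto intro: inc_walk_weaken)
next
  case (Cons x p)
  then show ?case by (cases p) auto
qed

lemma inc_walk_prefix: "inc_walk E t (p @ w # q) b \<Longrightarrow> inc_walk E t (p @ [w]) b"
proof (induction p arbitrary: t)
  case Nil
  then show ?case by (auto dest: inc_walk_le)
next
  case (Cons x p)
  then show ?case by (cases p) auto
qed

lemma inc_walk_suffix: "inc_walk E t (p @ w # q) b \<Longrightarrow> inc_walk E t (w # q) b"
proof (induction p arbitrary: t)
  case Nil
  then show ?case by auto
next
  case (Cons x p)
  have "inc_walk E t (p @ w # q) b"
    using Cons.prems by (cases p) (auto elim!: inc_walk_weaken)
  then show ?case by (rule Cons.IH)
qed

lemma inc_walk_last_edge:
  "inc_walk E t (p @ [y, w]) b \<Longrightarrow>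
    (y, w) \<in> E \<and> t \<le> T y w \<and> inc_walk E t (p @ [y, w]) (Suc (T y w))"
proof (induction p arbitrary: t)
  case Nil
  then show ?case by auto
next
  case (Cons x p)
  show ?case
  proof (cases p)
    case Nil
    then show ?thesis using Cons.prems by auto
  next
    case (Cons z p')
    then show ?thesis using Cons.prems Cons.IH[of "Suc (T x z)"] by auto
  qed
qed

text \<open>If the start \<open>u\<close> recurs in the shortened tail, the walk can begin at that
  recurrence: it then departs later, so the bound \<open>t\<close> still holds.\<close>

lemma inc_walk_distinct:
  "inc_walk E t vs b \<Longrightarrow>
    \<exists>vs'. inc_walk E t vs' b \<and> distinct vs' \<and> hd vs' = hd vs \<and> last vs' = last vs \<and> set vs' \<subseteq> set vs"
proof (induction E t vs b rule: inc_walk.induct)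
  case (1 E t b)
  then show ?case by simp
next
  case (2 E t v b)
  then show ?case by (intro exI[of _ "[v]"]) auto
next
  case (3 E t u v vs b)
  then obtain vs' where vs': "inc_walk E (Suc (T u v)) vs' b" "distinct vs'" "hd vs' = v"
      "last vs' = last (v # vs)" "set vs' \<subseteq> set (v # vs)" by auto
  have ne: "vs' \<noteq> []" using vs'(1) by auto
  show ?case
  proof (cases "u \<in> set vs'")
    case True
    then obtain p q where pq: "vs' = p @ u # q" by (auto simp: in_set_conv_decomp)
    have "inc_walk E t (u # q) b"
      using inc_walk_suffix[of E "Suc (T u v)" p u q b] vs'(1) pq "3.prems"
      by (auto elim!: inc_walk_weaken)
    then show ?thesis using vs' pq by (intro exI[of _ "u # q"]) auto
  next
    case False
    obtain q where q: "vs' = v # q" using ne vs'(3) by (cases vs') auto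
    show ?thesis using vs' q False "3.prems" by (intro exI[of _ "u # vs'"]) auto
  qed
qed

lemma inc_path_trivial: "v \<notin> X \<Longrightarrow> inc_path E t v 0 X"
  unfolding inc_path_def by (intro exI[of _ "[v]"] exI[of _ t]) auto

lemma inc_path_mono:
  assumes "inc_path E t v l X" "t' \<le> t" "E \<subseteq> E'" "X' \<subseteq> X"
  shows "inc_path E' t' v l X'"
  using assms(1,4) inc_walk_weaken[OF _ assms(2) order_refl assms(3)] unfolding inc_path_def
  by (metis disjoint_iff subsetD)

lemma inc_pathI:
  assumes "inc_walk E t vs b" "distinct vs" "hd vs = v" "l < length vs" "set vs \<inter> X = {}"
  shows "inc_path E t v l X"
proof -
  have 1: "vs = take l vs @ vs ! l # drop (Suc l) vs"
    using assms(4) by (simp add: id_take_nth_drop)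
  have "inc_walk E t (take l vs @ [vs ! l]) b"
    using inc_walk_prefix[of E t "take l vs" "vs ! l" "drop (Suc l) vs" b] assms(1) 1 by simp
  then have "inc_walk E t (take (Suc l) vs) b"
    using assms(4) by (simp add: take_Suc_conv_app_nth)
  moreover have "set (take (Suc l) vs) \<inter> X = {}"
    using assms(5) set_take_subset by fastforce
  moreover have "hd (take (Suc l) vs) = v" using assms(3,4) by (cases vs) auto
  ultimately show ?thesis unfolding inc_path_def
    using assms by (intro exI[of _ "take (Suc l) vs"] exI[of _ b]) auto
qed

lemma inc_path_shorter: "inc_path E t v l X \<Longrightarrow> l' \<le> l \<Longrightarrow> inc_path E t v l' X"
  by (auto simp: inc_path_def[of E t v l X] intro: inc_pathI)

lemma inc_path_append:
  assumes "inc_walk E t (p @ [w]) a" "distinct (p @ [w])" "set (p @ [w]) \<inter> X = {}"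
    "inc_path E a w l (X \<union> set p)"
  shows "inc_path E t (hd (p @ [w])) (length p + l) X"
proof -
  obtain vs b where vs: "inc_walk E a vs b" "distinct vs" "hd vs = w" "length vs = Suc l"
    "set vs \<inter> (X \<union> set p) = {}" using assms(4) unfolding inc_path_def by blast
  then obtain q where q: "vs = w # q" by (cases vs) auto
  have "inc_walk E t (p @ w # q) b" using inc_walk_append assms(1) vs(1) q by blast
  then show ?thesis
    by (rule inc_pathI) (use assms vs q in \<open>auto simp: hd_append\<close>)
qed

lemma timed_graph_subset:
  "timed_graph V E \<Longrightarrow> E' \<subseteq> E \<Longrightarrow> sym E' \<Longrightarrow> E' \<subseteq> V' \<times> V' \<Longrightarrow> finite V' \<Longrightarrow> timed_graph V' E'"
  unfolding timed_graph_def irrefl_def by (meson subsetD)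


subsection \<open>From robust short paths to long paths\<close>

text \<open>
  The budget \<open>card X + g \<le> x\<close> leaves room for the \<open>l\<close> vertices that are prepended when the path is
  lengthened, and quantifying over all \<open>g \<le> f\<close> makes the notion antitone in \<open>f\<close>.
\<close>

definition robust :: "('a \<times> 'a) set \<Rightarrow> nat \<Rightarrow> nat \<Rightarrow> 'a \<Rightarrow> nat \<Rightarrow> bool" where
  "robust E x t v f \<longleftrightarrow>
     (\<forall>g\<le>f. \<forall>X. finite X \<longrightarrow> v \<notin> X \<longrightarrow> card X + g \<le> x \<longrightarrow> inc_path E t v g X)"

lemma robust_mono:
  "robust E x t v f \<Longrightarrow> t' \<le> t \<Longrightarrow> f' \<le> f \<Longrightarrow> robust E x t' v f'"
  unfolding robust_def by (meson dual_order.trans inc_path_mono order_refl)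

lemma robust_0: "robust E x t v 0"
  unfolding robust_def by (auto intro: inc_path_trivial)

text \<open>\<open>X\<close> is too small to contain \<open>W\<close>, so some \<open>w\<close> in
  \<open>W\<close> is free. Going there shortens the remaining path by one and adds \<open>v\<close>
  to the forbidden set, which leaves the budget unchanged.\<close>

lemma robust_step:
  assumes "irrefl E" "x < card W"
    and W: "\<And>w. w \<in> W \<Longrightarrow> (v, w) \<in> E \<and> t \<le> T v w \<and> robust E x (Suc (T v w)) w f"
  shows "robust E x t v (Suc f)"
  unfolding robust_def
proof (intro allI impI)
  fix g X assume g: "g \<le> Suc f" and X: "finite X" "v \<notin> X" "card X + g \<le> x"
  show "inc_path E t v g X"
  proof (cases g)
    case 0
    then show ?thesis using X by (auto intro: inc_path_trivial)
  next
    case (Suc g')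
    have "\<not> W \<subseteq> X"
      using card_mono[OF X(1), of W] X(3) assms(2) by linarith
    then obtain w where w: "w \<in> W" "w \<notin> X" by auto
    then have "w \<noteq> v" using W[of w] assms(1) by (auto simp: irrefl_def)
    then have "inc_path E (Suc (T v w)) w g' (insert v X)"
      using W[OF w(1)] g X Suc w unfolding robust_def by (auto simp: card_insert_if)
    then have "inc_path E t (hd ([v] @ [w])) (length [v] + g') X"
      by (intro inc_path_append[where a = "Suc (T v w)"]) (use W[OF w(1)] \<open>w \<noteq> v\<close> w X in auto)
    then show ?thesis using Suc by simp
  qed
qed

text \<open>For a length \<open>g > f\<close>, follow a path in \<open>H\<close> for
  \<open>g - f\<close> edges and continue robustly from its end, avoiding also the
  \<open>g - f\<close> vertices passed before. The budget fits exactly: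
  \<open>card X + (g - f) + f \<le> x\<close>.\<close>

lemma robust_extend:
  assumes "H \<subseteq> E" "robust E x t v f"
    and path: "\<And>X. finite X \<Longrightarrow> card X \<le> x \<Longrightarrow> v \<notin> X \<Longrightarrow> inc_path H t v l X"
    and H: "\<And>y w. (y, w) \<in> H \<Longrightarrow> robust E x (Suc (T y w)) w f"
  shows "robust E x t v (f + l)"
  unfolding robust_def
proof (intro allI impI)
  fix g X assume g: "g \<le> f + l" and X: "finite X" "v \<notin> X" "card X + g \<le> x"
  show "inc_path E t v g X"
  proof (cases "g \<le> f")
    case True
    then show ?thesis using X assms(2) unfolding robust_def by blast
  next
    case False
    then obtain e where e: "g = f + Suc e" "Suc e \<le> l"
      using g by (metis add_Suc_right add_le_cancel_left less_imp_Suc_add not_le)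
    have "inc_path H t v (Suc e) X"
      using inc_path_shorter[OF path e(2), of X] X by auto
    then obtain vs b where vs: "inc_walk H t vs b" "distinct vs" "hd vs = v"
      "length vs = Suc (Suc e)" "set vs \<inter> X = {}" unfolding inc_path_def by blast
    obtain us w where us: "vs = us @ [w]" "length us = Suc e"
      using vs(4) by (metis length_Suc_conv_rev)
    obtain p y where py: "us = p @ [y]" "length p = e" using us(2) by (metis length_Suc_conv_rev)
    have vs_eq: "vs = p @ [y, w]" using us py by simp
    have le: "(y, w) \<in> H" "inc_walk H t (p @ [y, w]) (Suc (T y w))"
      using inc_walk_last_edge vs(1) vs_eq by blast+
    have "card (X \<union> set us) \<le> card X + Suc e"
      using card_Un_le[of X "set us"] card_length[of us] us(2) by linarith
    then have "inc_path E (Suc (T y w)) w f (X \<union> set us)"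
      using H[OF le(1)] X e vs us unfolding robust_def by auto
    then have "inc_path E t (hd (us @ [w])) (length us + f) X"
      by (intro inc_path_append[where a = "Suc (T y w)"])
        (use inc_walk_weaken[OF le(2) order_refl order_refl assms(1)] vs vs_eq us py in auto)
    then show ?thesis using vs us e by (simp add: add.commute)
  qed
qed

lemma forces_level_up:
  assumes forces: "forces N m x l" and sl: "s * l \<le> x"
  shows "forces N (s * (m + 2 * x + 2)) 0 (s * l)"
  unfolding forces_def
proof (intro allI impI)
  fix V E assume G: "timed_graph V E" and V: "V \<noteq> {}" "card V \<le> N"
    and E: "s * (m + 2 * x + 2) * card V \<le> card E"
  note G' = G[unfolded timed_graph_def]
  have finV: "finite V" and EV: "E \<subseteq> V \<times> V" and symE: "sym E" and irr: "irrefl E" using G' by auto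
  have inj: "v = w" if "(u, v) \<in> E" "(u, w) \<in> E" "T u v = T u w" for u v w
    using G' that by blast
  have finE: "finite E" using finV EV finite_subset by blast
  \<comment> \<open>Since \<open>s * l \<le> x\<close>, the budget admits \<open>X = {}\<close> at
    length \<open>s * l\<close>, so this is enough.\<close>
  have "\<exists>v\<in>V. robust E x 0 v (s * l)"
  proof (rule ccontr)
    assume "\<not> ?thesis"
    then have contra: "\<not> robust E x t v (s * l)" if "v \<in> V" for v t
      using robust_mono[of E x t v "s * l" 0 "s * l"] that by auto
    have s: "0 < s" using V contra robust_0 by fastforce
    \<comment> \<open>The class of \<open>v\<close> at time \<open>t\<close>, which can only fall as
      \<open>t\<close> grows. By \<open>contra\<close> the cap \<open>a < s\<close> cuts nothing off
      for vertices of \<open>V\<close>.\<close>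
    define c where "c t v = Max {a. a < s \<and> robust E x t v (a * l)}" for t v
    have c: "c t v < s" "robust E x t v (c t v * l)" for t v
    proof -
      have "c t v \<in> {a. a < s \<and> robust E x t v (a * l)}"
        unfolding c_def by (rule Max_in) (use s robust_0 in \<open>auto intro!: exI[of _ 0]\<close>)
      then show "c t v < s" "robust E x t v (c t v * l)" by auto
    qed
    have c_ge: "a \<le> c t v" if "v \<in> V" "robust E x t v (a * l)" for a t v
    proof -
      have "a < s"
      proof (rule ccontr)
        assume "\<not> a < s"
        then have "robust E x t v (s * l)"
          using robust_mono[OF that(2), of t "s * l"] by simp
        then show False using contra that by blast
      qed
      then show ?thesis using that unfolding c_def by (intro Max_ge) auto
    qed
    have c_anti: "c t' v \<le> c t v" if "v \<in> V" "t \<le> t'" for t t' v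
      using c_ge[OF that(1)] robust_mono[OF c(2)[of t' v] that(2) order_refl] by blast
    \<comment> \<open>\<open>Tr\<close>: an end changes class as the edge passes. \<open>Up\<close>:
      the edge leads to a higher class. \<open>H a\<close>: both ends have class \<open>a\<close>
      before and after. The bounds per vertex are \<open>s\<close>, \<open>s * x\<close> and, over
      all \<open>a\<close>, \<open>s * m\<close>; the first two count in both orientations, whence
      \<open>s * (m + 2 * x + 2)\<close>.\<close>
    define Tr where "Tr = {(v, w). (v, w) \<in> E \<and> c (Suc (T v w)) v < c (T v w) v}"
    define Up where "Up = {(v, w). (v, w) \<in> E \<and> c (T v w) v < c (Suc (T v w)) w}"
    define H where "H a = {(v, w). (v, w) \<in> E \<and> c (T v w) v = a \<and> c (T v w) w = a \<and>
        c (Suc (T v w)) v = a \<and> c (Suc (T v w)) w = a}" for a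
    have Tr: "card Tr \<le> s * card V"
    proof (rule card_rel_le[OF finV])
      show "Tr \<subseteq> V \<times> V" using EV by (auto simp: Tr_def)
      fix v assume v: "v \<in> V"
      have ne: "c (T v w) v \<noteq> c (T v w') v"
        if "w \<in> Tr `` {v}" "w' \<in> Tr `` {v}" "T v w < T v w'" for w w'
        using that c_anti[OF v, of "Suc (T v w)" "T v w'"] by (auto simp: Tr_def)
      have "inj_on (\<lambda>w. c (T v w) v) (Tr `` {v})"
      proof (rule inj_onI)
        fix w w' assume *: "w \<in> Tr `` {v}" "w' \<in> Tr `` {v}" "c (T v w) v = c (T v w') v"
        then have "T v w = T v w'" using ne[of w w'] ne[of w' w] by (metis linorder_neqE_nat)
        then show "w = w'" using inj * by (auto simp: Tr_def)
      qed
      moreover have "(\<lambda>w. c (T v w) v) ` (Tr `` {v}) \<subseteq> {..<s}" using c(1) by auto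
      ultimately show "card (Tr `` {v}) \<le> s"
        by (metis card_inj_on_le card_lessThan finite_lessThan)
    qed
    have Up: "card Up \<le> (s * x) * card V"
    proof (rule card_rel_le[OF finV])
      show "Up \<subseteq> V \<times> V" using EV by (auto simp: Up_def)
      fix v assume v: "v \<in> V"
      have finUp: "finite (Up `` {v})"
        by (rule finite_subset[OF _ finV]) (use EV in \<open>auto simp: Up_def\<close>)
      define W where "W a = {w \<in> Up `` {v}. c (T v w) v = a}" for a
      have "card (W a) \<le> x" for a
      proof (rule ccontr)
        assume big: "\<not> card (W a) \<le> x"
        then have "finite (W a)" "W a \<noteq> {}" using card.infinite by fastforce+
        \<comment> \<open>At the earliest time \<open>t\<close> of an edge from \<open>v\<close> to
          \<open>W a\<close> the class of \<open>v\<close> is \<open>a\<close>, but more than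
          \<open>x\<close> neighbours of higher class are still ahead, and
          \<open>robust_step\<close> lifts \<open>v\<close>.\<close>
        define t where "t = Min (T v ` W a)"
        have "t \<in> T v ` W a" unfolding t_def
          using \<open>finite (W a)\<close> \<open>W a \<noteq> {}\<close> by (intro Min_in) auto
        then obtain w0 where w0: "w0 \<in> W a" "t = T v w0" by auto
        have "robust E x t v (Suc (Suc a * l))"
        proof (rule robust_step[OF irr])
          show "x < card (W a)" using big by simp
          fix w assume w: "w \<in> W a"
          then have "Suc a \<le> c (Suc (T v w)) w" by (auto simp: W_def Up_def)
          then have "robust E x (Suc (T v w)) w (Suc a * l)"
            by (intro robust_mono[OF c(2)] mult_le_mono1) auto
          then show "(v, w) \<in> E \<and> t \<le> T v w \<and> robust E x (Suc (T v w)) w (Suc a * l)"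
            using w \<open>finite (W a)\<close> by (auto simp: W_def Up_def t_def)
        qed
        then have "robust E x t v (Suc a * l)" by (rule robust_mono) auto
        then have "Suc a \<le> c t v" using c_ge v by blast
        then show False using w0 by (auto simp: W_def)
      qed
      moreover have "Up `` {v} = (\<Union>a<s. W a)" using c(1) by (auto simp: W_def)
      ultimately have "card (Up `` {v}) \<le> (\<Sum>a<s. x)"
        using card_UN_le[of "{..<s}" W] by (metis (no_types, lifting) finite_lessThan order_trans sum_mono)
      then show "card (Up `` {v}) \<le> s * x" by simp
    qed
    have HE: "H a \<subseteq> E" for a by (auto simp: H_def)
    have H: "card (H a) < m * card V" for a
    proof (rule ccontr)
      assume "\<not> card (H a) < m * card V"
      then have big: "m * card V \<le> card (H a)" by simp
      have "sym (H a)" using symE by (auto simp: H_def sym_def T_commute)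
      then have "timed_graph V (H a)"
        using timed_graph_subset[OF G HE[of a]] HE[of a] EV finV by blast
      then obtain v where v: "v \<in> V"
        "\<And>X. finite X \<Longrightarrow> card X \<le> x \<Longrightarrow> v \<notin> X \<Longrightarrow> inc_path (H a) 0 v l X"
        using forces V big unfolding forces_def by meson
      have "l \<noteq> 0" using robust_0 contra V by fastforce
      \<comment> \<open>The forced path has a first edge because \<open>l \<noteq> 0\<close>, and
        this edge is in \<open>H a\<close>. So the path departs no earlier than \<open>t\<close>,
        when \<open>v\<close> has class \<open>a\<close>, and \<open>robust_extend\<close> lifts
        \<open>v\<close> to \<open>Suc a\<close>.\<close>
      define t where "t = Min (T v ` (H a `` {v}))"
      have fin: "finite (H a `` {v})"
        by (rule finite_subset[OF _ finV]) (use EV HE in auto)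
      have path: "inc_path (H a) t v l X \<and> H a `` {v} \<noteq> {}"
        if X: "finite X" "card X \<le> x" "v \<notin> X" for X
      proof -
        obtain vs b where vs: "inc_walk (H a) 0 vs b" "distinct vs" "hd vs = v"
          "length vs = Suc l" "set vs \<inter> X = {}" using v(2)[OF X] unfolding inc_path_def by blast
        obtain w q where q: "vs = v # w # q"
          using vs(3,4) \<open>l \<noteq> 0\<close> by (cases vs; cases "tl vs") auto
        then have w: "w \<in> H a `` {v}" using vs by auto
        then have "t \<le> T v w" using fin by (auto simp: t_def)
        then have "inc_walk (H a) t vs b" using vs(1) q by auto
        then show ?thesis using vs w unfolding inc_path_def by blast
      qed
      have "H a `` {v} \<noteq> {}" using path[of "{}"] by simp
      then have "t \<in> T v ` (H a `` {v})" unfolding t_def using fin by (intro Min_in) auto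
      then have cta: "c t v = a" by (auto simp: H_def)
      have "robust E x t v (a * l + l)"
      proof (rule robust_extend[OF HE])
        show "robust E x t v (a * l)" using c(2)[of t v] cta by simp
        show "inc_path (H a) t v l X" if "finite X" "card X \<le> x" "v \<notin> X" for X
          using path that by blast
        show "robust E x (Suc (T y w)) w (a * l)" if "(y, w) \<in> H a" for y w
          using c(2)[of "Suc (T y w)" w] that by (auto simp: H_def)
      qed
      then have "robust E x t v (Suc a * l)" by (simp add: add.commute)
      then have "Suc a \<le> c t v" using c_ge v(1) by blast
      then show False using cta by simp
    qed
    have cover: "E \<subseteq> Tr \<union> Tr\<inverse> \<union> Up \<union> Up\<inverse> \<union> (\<Union>a<s. H a)"
    proof
      fix e assume "e \<in> E"
      then obtain v w where e: "e = (v, w)" "(v, w) \<in> E" "(w, v) \<in> E" "v \<in> V" "w \<in> V"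
        using symE EV by (cases e) (auto simp: sym_def)
      let ?t = "T v w"
      have T: "T w v = ?t" by (rule T_commute)
      have "c (Suc ?t) v \<le> c ?t v" "c (Suc ?t) w \<le> c ?t w" using c_anti e by auto
      then consider "c (Suc ?t) v < c ?t v" | "c (Suc ?t) w < c ?t w" | "c ?t v < c (Suc ?t) w"
        | "c ?t w < c (Suc ?t) v"
        | "c ?t v = c ?t w" "c (Suc ?t) v = c ?t v" "c (Suc ?t) w = c ?t v" by linarith
      then show "e \<in> Tr \<union> Tr\<inverse> \<union> Up \<union> Up\<inverse> \<union> (\<Union>a<s. H a)"
      proof cases
        case 5
        then have "e \<in> H (c ?t v)" using e by (auto simp: H_def)
        then show ?thesis using c(1) by blast
      qed (use e T in \<open>auto simp: Tr_def Up_def\<close>)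
    qed
    have "Tr \<subseteq> E" "Up \<subseteq> E" by (auto simp: Tr_def Up_def)
    then have fin: "finite Tr" "finite Up" using finE finite_subset by blast+
    have "card (\<Union>a<s. H a) \<le> (\<Sum>a<s. card (H a))" by (rule card_UN_le) auto
    also have "\<dots> < (\<Sum>a<s. m * card V)" using s by (intro sum_strict_mono H) auto
    finally have HH: "card (\<Union>a<s. H a) < s * (m * card V)" by simp
    have "card E \<le> card (Tr \<union> Tr\<inverse> \<union> Up \<union> Up\<inverse> \<union> (\<Union>a<s. H a))"
      using cover fin finE HE by (intro card_mono) (auto intro: finite_subset)
    also have "\<dots> \<le> card Tr + card (Tr\<inverse>) + card Up + card (Up\<inverse>) + card (\<Union>a<s. H a)"
      by (intro order_trans[OF card_Un_le] add_mono order_refl)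
    finally have "card E < 2 * (s * card V) + 2 * (s * x * card V) + s * (m * card V)"
      using Tr Up HH by simp
    also have "\<dots> = s * (m + 2 * x + 2) * card V" by (simp add: algebra_simps)
    finally show False using E by simp
  qed
  then show "\<exists>v\<in>V. \<forall>X. finite X \<longrightarrow> card X \<le> 0 \<longrightarrow> v \<notin> X \<longrightarrow> inc_path E 0 v (s * l) X"
    using sl unfolding robust_def by (metis add.commute add_0_right le_zero_eq order_refl)
qed

subsection \<open>From long paths to robust short paths\<close>

lemma inc_walk_appendD1: "inc_walk E t (p @ q) b \<Longrightarrow> p \<noteq> [] \<Longrightarrow> inc_walk E t p b"
  by (cases p rule: rev_cases) (auto dest: inc_walk_prefix)

lemma inc_walk_verts: "inc_walk E t vs b \<Longrightarrow> E \<subseteq> A \<times> A \<Longrightarrow> hd vs \<in> A \<Longrightarrow> set vs \<subseteq> A"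
  by (induction E t vs b rule: inc_walk.induct) auto

text \<open>As \<open>p\<close> has at most \<open>h\<close> vertices, \<open>list_gap\<close> finds
  a vertex \<open>w\<close> of \<open>p\<close> on \<open>q\<close> that is followed by
  \<open>l\<close> vertices off \<open>p\<close>. Follow \<open>p\<close> to \<open>w\<close>,
  shortcut to a path, then go along \<open>q\<close>; the times fit because all of \<open>q\<close>
  comes after \<open>p\<close>.\<close>

lemma inc_path_join:
  assumes p: "inc_walk E t p a" and q: "inc_walk E a q b" and "last p = hd q" "distinct q"
    and "length p \<le> h" "h * l < length q" and X: "set p \<inter> X = {}" "set q \<inter> X = {}"
  shows "inc_path E t (hd p) l X"
proof -
  have ne: "p \<noteq> []" "q \<noteq> []" using p q by auto
  have "card (set p \<inter> set q) \<le> card (set p)" by (intro card_mono) auto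
  also have "\<dots> \<le> h" using card_length[of p] assms(5) by linarith
  finally obtain xs w f ys where f: "q = xs @ w # f @ ys" "w \<in> set p" "set f \<inter> set p = {}" "length f = l"
    using list_gap[of q "set p" h l] ne assms(3,4,6) by (metis last_in_set)
  obtain p1 p2 where p12: "p = p1 @ w # p2" using f(2) by (auto simp: in_set_conv_decomp)
  have "inc_walk E t (p1 @ [w]) a" using inc_walk_prefix p p12 by blast
  then obtain r where r: "inc_walk E t r a" "distinct r" "hd r = hd (p1 @ [w])" "last r = w"
      "set r \<subseteq> set (p1 @ [w])" using inc_walk_distinct by fastforce
  have r_ne: "r \<noteq> []" using r(1) by auto
  have r_eq: "r = butlast r @ [w]" using r_ne r(4) by (metis append_butlast_last_id)
  have "inc_walk E a ((w # f) @ ys) b" using inc_walk_suffix[of E a xs w "f @ ys" b] q f(1) by simp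
  then have "inc_walk E a (w # f) b" using inc_walk_appendD1 by blast
  then have "inc_walk E t (butlast r @ w # f) b" using inc_walk_append r(1) r_eq by metis
  then have "inc_walk E t (r @ f) b" using r_eq by (metis append.assoc append_Cons append_Nil)
  then show ?thesis
  proof (rule inc_pathI)
    show "distinct (r @ f)" using r p12 f assms(4) by auto
    show "hd (r @ f) = hd p" using r(3) r_ne p12 by (simp add: hd_append)
    show "l < length (r @ f)" using r_ne f(4) by simp
    show "set (r @ f) \<inter> X = {}" using r(5) f(1) p12 X by auto
  qed
qed

text \<open>Made so that an arrival at \<open>w\<close> along an edge of \<open>peel d E\<close>
  leaves \<open>d\<close> later edges of \<open>E\<close> to continue with. Testing both ends keeps
  the relation symmetric.\<close>

definition peel :: "nat \<Rightarrow> ('a \<times> 'a) set \<Rightarrow> ('a \<times> 'a) set" where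
  "peel d E = {(u, w). (u, w) \<in> E \<and> d \<le> card {y. (u, y) \<in> E \<and> T u w < T u y} \<and>
     d \<le> card {y. (w, y) \<in> E \<and> T u w < T w y}}"

lemma timed_graph_peel:
  assumes "timed_graph V E"
  shows "timed_graph V (peel d E)"
proof (rule timed_graph_subset[OF assms])
  show "peel d E \<subseteq> E" by (auto simp: peel_def)
  then show "peel d E \<subseteq> V \<times> V" using assms by (auto simp: timed_graph_def)
  show "sym (peel d E)" using assms by (auto simp: peel_def timed_graph_def sym_def T_commute)
  show "finite V" using assms by (auto simp: timed_graph_def)
qed

text \<open>The edges at one vertex have distinct numbers of later edges, so at most
  \<open>d\<close> of them have fewer than \<open>d\<close>. A deleted pair fails at one of its two
  ends, hence the factor 2.\<close>

lemma card_peel: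
  assumes G: "timed_graph V E"
  shows "card E \<le> card (peel d E) + 2 * d * card V"
proof -
  have finV: "finite V" and EV: "E \<subseteq> V \<times> V" and symE: "sym E" using G by (auto simp: timed_graph_def)
  have inj: "v = w" if "(u, v) \<in> E" "(u, w) \<in> E" "T u v = T u w" for u v w
    using G that unfolding timed_graph_def by blast
  have finE: "finite E" using finV EV finite_subset by blast
  define later where "later u w = {y. (u, y) \<in> E \<and> T u w < T u y}" for u w
  have fin: "finite (later u w)" for u w
    by (rule finite_subset[OF _ finV]) (use EV in \<open>auto simp: later_def\<close>)
  define L where "L = {(u, w). (u, w) \<in> E \<and> card (later u w) < d}"
  have "L \<subseteq> E" by (auto simp: L_def)
  have "card L \<le> d * card V"
  proof (rule card_rel_le[OF finV])
    show "L \<subseteq> V \<times> V" using EV by (auto simp: L_def)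
    fix v assume "v \<in> V"
    have ne: "card (later v w) \<noteq> card (later v w')" if "(v, w') \<in> E" "T v w < T v w'" for w w'
    proof -
      have "later v w' \<subset> later v w" using that by (auto simp: later_def)
      then show ?thesis using psubset_card_mono[OF fin] by (metis less_irrefl)
    qed
    have "inj_on (\<lambda>w. card (later v w)) (L `` {v})"
    proof (rule inj_onI)
      fix w w' assume *: "w \<in> L `` {v}" "w' \<in> L `` {v}" "card (later v w) = card (later v w')"
      then have "T v w = T v w'" using ne[of w w'] ne[of w' w] by (auto simp: L_def) (metis linorder_neqE_nat)
      then show "w = w'" using inj * by (auto simp: L_def)
    qed
    moreover have "(\<lambda>w. card (later v w)) ` (L `` {v}) \<subseteq> {..<d}" by (auto simp: L_def)
    ultimately show "card (L `` {v}) \<le> d"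
      by (metis card_inj_on_le card_lessThan finite_lessThan)
  qed
  moreover have "E \<subseteq> peel d E \<union> L \<union> L\<inverse>"
    using symE by (auto simp: peel_def L_def later_def sym_def T_commute)
  then have "card E \<le> card (peel d E \<union> L \<union> L\<inverse>)"
    by (rule card_mono[rotated]) (use finE \<open>L \<subseteq> E\<close> in \<open>auto simp: peel_def intro: finite_subset\<close>)
  moreover have "card (peel d E \<union> L \<union> L\<inverse>) \<le> card (peel d E) + card L + card (L\<inverse>)"
    by (intro order_trans[OF card_Un_le] add_mono order_refl)
  ultimately show ?thesis by simp
qed

text \<open>Peeling \<open>Suc J\<close> times with \<open>4 * d\<close> costs
  \<open>8 * Suc J * d\<close> per vertex, so an edge is left. \<open>X\<close> blocks
  \<open>d\<close> of \<open>4 * d\<close> continuations; the other \<open>3 * d\<close> give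
  average degree \<open>d\<close> on \<open>R i \<union> R (Suc i)\<close> if this set has at most
  three times the size of \<open>R i\<close>.\<close>

lemma forces_robust:
  assumes forces: "forces N d 0 (Suc J * l + 1)" and d: "0 < d" and N: "N < 2 ^ J"
  shows "forces N (9 * Suc J * d) d l"
  unfolding forces_def
proof (intro allI impI)
  fix V E assume G: "timed_graph V E" and V: "V \<noteq> {}" "card V \<le> N"
    and E: "9 * Suc J * d * card V \<le> card E"
  have finV: "finite V" and EV: "E \<subseteq> V \<times> V" and symE: "sym E" using G by (auto simp: timed_graph_def)
  have finE: "finite E" using finV EV finite_subset by blast
  define P where "P i = (peel (4 * d) ^^ i) E" for i
  have P_Suc: "P (Suc i) = peel (4 * d) (P i)" for i by (simp add: P_def)
  have P_graph: "timed_graph V (P i)" for i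
    by (induction i) (use G timed_graph_peel in \<open>auto simp: P_def\<close>)
  have P_sub: "P i \<subseteq> E" for i by (induction i) (auto simp: P_def peel_def)
  have "card E \<le> card (P i) + i * (8 * d * card V)" for i
  proof (induction i)
    case (Suc i)
    then show ?case using card_peel[OF P_graph, of i "4 * d"] by (simp add: P_Suc)
  qed (simp add: P_def)
  from this[of "Suc J"] have "9 * Suc J * d * card V \<le> card (P (Suc J)) + 8 * Suc J * d * card V"
    using E by (simp add: algebra_simps)
  moreover have "8 * Suc J * d * card V < 9 * Suc J * d * card V"
    using d V finV by (intro mult_strict_right_mono) (auto simp: card_gt_0_iff)
  ultimately have "card (P (Suc J)) \<noteq> 0" by linarith
  then obtain v u0 where vu0: "(v, u0) \<in> P (Suc J)" by (metis card.empty ex_in_conv surj_pair)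
  have v: "v \<in> V" using vu0 P_sub EV by blast
  have "inc_path E 0 v l X" if X: "finite X" "card X \<le> d" "v \<notin> X" for X
  proof (rule ccontr)
    assume no_path: "\<not> inc_path E 0 v l X"
    \<comment> \<open>The exploration uses walks; \<open>inc_path_join\<close> removes repetitions
      in the end. Step \<open>i\<close> goes along \<open>P (J - i)\<close>, which is peeled once
      more than \<open>P (J - Suc i)\<close>, so \<open>4 * d\<close> continuations await at the
      next vertex.\<close>
    define arr where "arr i u a \<longleftrightarrow> (\<exists>vs. inc_walk E 0 vs a \<and> hd vs = v \<and> last vs = u \<and>
        length vs = Suc i \<and> set vs \<inter> X = {})" for i u a
    define R where "R i = {u \<in> V. \<exists>a. arr i u a \<and> 4 * d \<le> card {y. (u, y) \<in> P (J - i) \<and> a \<le> T u y}}" for i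
    define D where "D i = {(u, y). u \<in> R i \<and> (u, y) \<in> P (J - i) \<and> y \<notin> X \<and> (\<exists>a. arr i u a \<and> a \<le> T u y)}" for i
    have finR: "finite (R i)" and RX: "R i \<inter> X = {}" for i
    proof -
      show "finite (R i)" using finV by (auto simp: R_def)
      have "u \<notin> X" if "arr i u a" for u a using that unfolding arr_def
        by (metis disjoint_iff last_in_set length_0_conv nat.distinct(1))
      then show "R i \<inter> X = {}" by (auto simp: R_def)
    qed
    have D_E: "D i \<subseteq> E" for i using P_sub by (auto simp: D_def)
    have finD: "finite (D i)" for i using finE D_E finite_subset by blast
    have R0: "v \<in> R 0"
    proof -
      \<comment> \<open>A one-vertex walk may end at any time; the edge to \<open>u0\<close> is not
        walked but certifies \<open>4 * d\<close> later edges at \<open>v\<close>.\<close>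
      have "arr 0 v (Suc (T v u0))" unfolding arr_def
        using X by (intro exI[of _ "[v]"]) auto
      moreover have "4 * d \<le> card {y. (v, y) \<in> P J \<and> Suc (T v u0) \<le> T v y}"
        using vu0 by (auto simp: P_Suc peel_def Suc_le_eq)
      ultimately show ?thesis using v by (auto simp: R_def)
    qed
    have D_R: "y \<in> R (Suc i)" if uyD: "(u, y) \<in> D i" and iJ: "i < J" for u y i
    proof -
      obtain a vs where a: "a \<le> T u y" and vs: "inc_walk E 0 vs a" "hd vs = v" "last vs = u"
        "length vs = Suc i" "set vs \<inter> X = {}" using uyD by (auto simp: D_def arr_def)
      have uy: "(u, y) \<in> P (J - i)" "y \<notin> X" "(u, y) \<in> E" using uyD D_E by (auto simp: D_def)
      have vs_ne: "vs \<noteq> []" using vs(4) by auto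
      then have vs_eq: "vs = butlast vs @ [u]" using vs(3) by (metis append_butlast_last_id)
      have "inc_walk E 0 (butlast vs @ u # [y]) (Suc (T u y))"
        by (rule inc_walk_append) (use vs(1) vs_eq a uy in auto)
      then have "inc_walk E 0 (vs @ [y]) (Suc (T u y))"
        using vs_eq by (metis append.assoc append_Cons append_Nil)
      then have "arr (Suc i) y (Suc (T u y))" unfolding arr_def
        using vs vs_ne uy by (intro exI[of _ "vs @ [y]"]) auto
      moreover have "J - i = Suc (J - Suc i)" using iJ by simp
      then have "4 * d \<le> card {z. (y, z) \<in> P (J - Suc i) \<and> Suc (T u y) \<le> T y z}"
        using uy(1) by (auto simp: P_Suc peel_def Suc_le_eq)
      moreover have "y \<in> V" using uy EV by auto
      ultimately show ?thesis by (auto simp: R_def)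
    qed
    have D_card: "3 * d * card (R i) \<le> card (D i)" for i
    proof (rule card_rel_ge[OF finD _ finR])
      fix u assume u: "u \<in> R i"
      then obtain a where a: "arr i u a" "4 * d \<le> card {y. (u, y) \<in> P (J - i) \<and> a \<le> T u y}"
        by (auto simp: R_def)
      have "{y. (u, y) \<in> P (J - i) \<and> a \<le> T u y} - X \<subseteq> D i `` {u}"
        using u a by (auto simp: D_def)
      then have "card ({y. (u, y) \<in> P (J - i) \<and> a \<le> T u y} - X) \<le> card (D i `` {u})"
        by (intro card_mono) (simp_all add: finD finite_Image)
      moreover have "card {y. (u, y) \<in> P (J - i) \<and> a \<le> T u y} - card X
          \<le> card ({y. (u, y) \<in> P (J - i) \<and> a \<le> T u y} - X)"
        by (rule diff_card_le_card_Diff[OF X(1)])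
      ultimately show "3 * d \<le> card (D i `` {u})" using a(2) X(2) by linarith
    qed
    have grow: "2 * card (R i) \<le> card (R (Suc i))" if i: "i < J" "R i \<noteq> {}" for i
    proof (rule ccontr)
      assume small: "\<not> ?thesis"
      define A where "A = R i \<union> R (Suc i)"
      define H where "H = D i \<union> (D i)\<inverse>"
      have DA: "D i \<subseteq> A \<times> A" using D_R[OF _ i(1)] by (auto simp: A_def D_def)
      have HE: "H \<subseteq> E" using D_E[of i] symE by (auto simp: H_def sym_def)
      have HA: "H \<subseteq> A \<times> A" using DA by (auto simp: H_def)
      have "timed_graph A H"
        by (rule timed_graph_subset[OF G HE _ HA]) (use finR in \<open>auto simp: H_def A_def sym_def\<close>)
      moreover have "A \<noteq> {}" using i by (auto simp: A_def)
      moreover have "card A \<le> N"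
      proof -
        have "card A \<le> card V" by (intro card_mono finV) (auto simp: A_def R_def)
        then show ?thesis using V by simp
      qed
      moreover have "d * card A \<le> card H"
      proof -
        have "card A \<le> card (R i) + card (R (Suc i))" unfolding A_def by (rule card_Un_le)
        then have "card A \<le> 3 * card (R i)" using small by simp
        then have "d * card A \<le> d * (3 * card (R i))" by (intro mult_le_mono2)
        also have "\<dots> \<le> card (D i)" using D_card[of i] by (simp add: mult.commute mult.left_commute)
        also have "\<dots> \<le> card H" unfolding H_def by (intro card_mono) (use finD in auto)
        finally show ?thesis .
      qed
      ultimately obtain w where "w \<in> A" "inc_path H 0 w (Suc J * l + 1) {}"
        using forces unfolding forces_def by (metis card.empty empty_iff finite.emptyI order_refl)
      then obtain vs b where vs: "inc_walk H 0 vs b" "distinct vs" "hd vs \<in> A"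
        "length vs = Suc (Suc J * l + 1)" unfolding inc_path_def by blast
      obtain q0 q1 q where q: "vs = q0 # q1 # q"
        using vs(4) by (cases vs; cases "tl vs") auto
      have "set vs \<subseteq> A" using inc_walk_verts[OF vs(1) HA vs(3)] .
      then have vsX: "set vs \<inter> X = {}" using RX by (auto simp: A_def)
      have edge: "(q0, q1) \<in> H" and tl: "inc_walk H (Suc (T q0 q1)) (q1 # q) b" using vs(1) q by auto
      \<comment> \<open>The first edge was explored from \<open>q0\<close> or from
        \<open>q1\<close>. In the second case the path is entered at \<open>q1\<close> and loses an
        edge, which explains the \<open>+ 1\<close> in the forced length.\<close>
      have "\<exists>a qs u. arr i u a \<and> inc_walk H a qs b \<and> hd qs = u \<and> Suc J * l < length qs \<and> distinct qs
          \<and> set qs \<subseteq> set vs"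
      proof (cases "(q0, q1) \<in> D i")
        case True
        then obtain a where "arr i q0 a" "a \<le> T q0 q1" by (auto simp: D_def)
        then show ?thesis using vs q
          by (intro exI[of _ a] exI[of _ vs] exI[of _ q0]) auto
      next
        case False
        then have "(q1, q0) \<in> D i" using edge by (auto simp: H_def)
        then obtain a where "arr i q1 a" "a \<le> T q0 q1" by (auto simp: D_def T_commute)
        then show ?thesis using vs q tl
          by (intro exI[of _ a] exI[of _ "q1 # q"] exI[of _ q1]) (auto elim!: inc_walk_weaken)
      qed
      then obtain a qs where arr: "arr i (hd qs) a"
        and qs: "inc_walk H a qs b" "Suc J * l < length qs" "distinct qs" "set qs \<subseteq> set vs" by blast
      obtain p where p: "inc_walk E 0 p a" "hd p = v" "last p = hd qs" "length p = Suc i" "set p \<inter> X = {}"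
        using arr unfolding arr_def by blast
      have "inc_path E 0 (hd p) l X"
        by (rule inc_path_join[OF p(1) inc_walk_weaken[OF qs(1) order_refl order_refl HE], where h = "Suc J"])
          (use p qs i vsX in auto)
      then show False using no_path p(2) by simp
    qed
    have "i \<le> J \<Longrightarrow> 2 ^ i \<le> card (R i)" for i
    proof (induction i)
      case 0
      then show ?case using R0 finR[of 0] by (auto simp: Suc_le_eq card_gt_0_iff)
    next
      case (Suc i)
      then have "R i \<noteq> {}" by auto
      then show ?case using grow[of i] Suc by simp
    qed
    then have "2 ^ J \<le> card (R J)" by simp
    also have "\<dots> \<le> card V" by (intro card_mono finV) (auto simp: R_def)
    finally show False using V N by simp
  qed
  then show "\<exists>v\<in>V. \<forall>X. finite X \<longrightarrow> card X \<le> d \<longrightarrow> v \<notin> X \<longrightarrow> inc_path E 0 v l X"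
    using v by blast
qed

subsection \<open>Iteration\<close>

lemma forces_mono:
  assumes "forces N d x l" "l' \<le> l" "d \<le> d'"
  shows "forces N d' x l'"
proof -
  have "d * c \<le> e" if "d' * c \<le> e" for c e :: nat
    using mult_le_mono1[OF assms(3)] that by (rule order_trans)
  then show ?thesis using assms(1) inc_path_shorter[OF _ assms(2)] unfolding forces_def by meson
qed

text \<open>The base of the iteration: some vertex has more than \<open>x\<close> neighbours, so
  \<open>X\<close> misses one.\<close>

lemma forces_single_edge: "forces N (x + 1) x 1"
  unfolding forces_def
proof (intro allI impI)
  fix V E assume G: "timed_graph V E" and V: "V \<noteq> {}" and E: "(x + 1) * card V \<le> card E"
  have finV: "finite V" and EV: "E \<subseteq> V \<times> V" and irr: "irrefl E" using G by (auto simp: timed_graph_def)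
  have "\<exists>v\<in>V. x < card (E `` {v})"
  proof (rule ccontr)
    assume "\<not> ?thesis"
    then have "card E \<le> x * card V" by (intro card_rel_le[OF finV EV]) (auto simp: not_less)
    moreover have "0 < card V" using V finV by (simp add: card_gt_0_iff)
    ultimately show False using E by simp
  qed
  then obtain v where v: "v \<in> V" "x < card (E `` {v})" by blast
  have "inc_path E 0 v 1 X" if X: "finite X" "card X \<le> x" "v \<notin> X" for X
  proof -
    have "\<not> E `` {v} \<subseteq> X" using card_mono[OF X(1), of "E `` {v}"] X(2) v(2) by linarith
    then obtain w where w: "(v, w) \<in> E" "w \<notin> X" by auto
    then have "v \<noteq> w" using irr by (auto simp: irrefl_def)
    then show ?thesis unfolding inc_path_def
      using w X by (intro exI[of _ "[v, w]"] exI[of _ "Suc (T v w)"]) auto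
  qed
  then show "\<exists>v\<in>V. \<forall>X. finite X \<longrightarrow> card X \<le> x \<longrightarrow> v \<notin> X \<longrightarrow> inc_path E 0 v 1 X"
    using v by blast
qed

text \<open>A round divides the length by about \<open>Suc J\<close> and multiplies it by
  \<open>s\<close>, a gain of \<open>r\<close>; the 2 in \<open>s\<close> absorbs the
  \<open>+ 1\<close> of \<open>forces_robust\<close>. The degree grows by
  \<open>13 * Suc J * s\<close>, so a round loses \<open>26 * Suc J ^ 2\<close> against it.\<close>

lemma forces_iterate:
  assumes N: "N < 2 ^ J" and r: "1 \<le> r" and s: "s = 2 * Suc J * r"
  shows "forces N (3 * s * (s + 1) * (13 * Suc J * s) ^ k) 0 (s * r ^ k)"
proof (induction k)
  case 0
  have "forces N (s * ((s + 1) + 2 * s + 2)) 0 (s * 1)"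
    by (rule forces_level_up[OF forces_single_edge]) simp
  then show ?case by (rule forces_mono) (simp_all add: algebra_simps)
next
  case (Suc k)
  define d where "d = 3 * s * (s + 1) * (13 * Suc J * s) ^ k"
  have s1: "1 \<le> s" using s r by simp
  then have d0: "0 < d" by (simp add: d_def)
  have "forces N d 0 (Suc J * r ^ Suc k + 1)"
  proof (rule forces_mono[OF Suc.IH[folded d_def] _ order_refl])
    have "0 < Suc J * r ^ Suc k" using r by (intro mult_pos_pos zero_less_power) auto
    moreover have "s * r ^ k = 2 * (Suc J * r ^ Suc k)" by (simp add: s algebra_simps)
    ultimately show "Suc J * r ^ Suc k + 1 \<le> s * r ^ k" by linarith
  qed
  then have "forces N (9 * Suc J * d) d (r ^ Suc k)" by (rule forces_robust[OF _ d0 N])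
  moreover have "s * r ^ Suc k \<le> d"
  proof -
    have "r \<le> s" using s by simp
    then have "s * r * r ^ k \<le> (3 * s * (s + 1)) * (13 * Suc J * s) ^ k"
      by (intro mult_le_mono power_mono) (auto simp: algebra_simps)
    then show ?thesis by (simp add: d_def mult.assoc)
  qed
  ultimately have "forces N (s * (9 * Suc J * d + 2 * d + 2)) 0 (s * r ^ Suc k)"
    by (rule forces_level_up)
  then show ?case
  proof (rule forces_mono[OF _ order_refl])
    have "9 * Suc J * d + 2 * d + 2 \<le> 13 * Suc J * d" using d0 by (simp add: algebra_simps)
    then have "s * (9 * Suc J * d + 2 * d + 2) \<le> s * (13 * Suc J * d)" by (rule mult_le_mono2)
    also have "\<dots> = 3 * s * (s + 1) * (13 * Suc J * s) ^ Suc k"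
      unfolding d_def power_Suc by (simp only: ac_simps)
    finally show "s * (9 * Suc J * d + 2 * d + 2) \<le> 3 * s * (s + 1) * (13 * Suc J * s) ^ Suc k" .
  qed
qed

end

subsection \<open>Complete graphs\<close>

lemma Kn_monotone_path:
  assumes R: "edge_ordering n R" and n: "2 \<le> n" "n < 2 ^ J" and r: "1 \<le> r" and s: "s = 2 * Suc J * r"
    and k: "3 * s * (s + 1) * (13 * Suc J * s) ^ k \<le> n - 1"
  shows "\<exists>vs. Kn_path n vs \<and> monotone_path R vs \<and> length vs - 1 = s * r ^ k"
proof -
  have lin: "linear_order_on (Kn_edges n) R" using R by (simp add: edge_ordering_def)
  \<comment> \<open>Counting the edges below \<open>e\<close> turns the order into times in
    \<open>nat\<close>.\<close>
  define rank where "rank e = card {f \<in> Kn_edges n. (f, e) \<in> R}" for e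
  define T where "T u v = rank {u, v}" for u v
  have "Kn_edges n \<subseteq> Pow {..<n}" by (auto simp: Kn_edges_def)
  then have fin: "finite (Kn_edges n)" by (rule finite_subset) simp
  have refl: "(e, e) \<in> R" if "e \<in> Kn_edges n" for e
    using lin that by (auto simp: linear_order_on_def partial_order_on_def preorder_on_def refl_on_def)
  have trans: "trans R" and anti: "antisym R" and total: "total_on (Kn_edges n) R"
    using lin by (auto simp: linear_order_on_def partial_order_on_def preorder_on_def)
  have rank_less: "rank e < rank f" if "(e, f) \<in> R" "e \<noteq> f" "e \<in> Kn_edges n" "f \<in> Kn_edges n" for e f
    unfolding rank_def
  proof (rule psubset_card_mono)
    show "finite {g \<in> Kn_edges n. (g, f) \<in> R}" using fin by simp
    have "(f, e) \<notin> R" using that anti by (auto simp: antisym_def)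
    then show "{g \<in> Kn_edges n. (g, e) \<in> R} \<subset> {g \<in> Kn_edges n. (g, f) \<in> R}"
      using that refl trans by (auto dest: transD)
  qed
  have rank_R: "(e, f) \<in> R" if "rank e < rank f" "e \<in> Kn_edges n" "f \<in> Kn_edges n" for e f
    using that rank_less[of f e] total by (metis less_asym less_irrefl total_on_def)
  have rank_inj: "e = f" if "rank e = rank f" "e \<in> Kn_edges n" "f \<in> Kn_edges n" for e f
    using that rank_less[of f e] rank_less[of e f] total by (metis less_irrefl total_on_def)
  interpret timed_edges T by unfold_locales (simp add: T_def insert_commute)
  define E where "E = (SIGMA u:{..<n}. {..<n} - {u})"
  have E_edge: "{u, v} \<in> Kn_edges n" if "(u, v) \<in> E" for u v
    using that by (auto simp: E_def Kn_edges_def)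
  have "v = w" if "(u, v) \<in> E" "(u, w) \<in> E" "T u v = T u w" for u v w
  proof -
    have "{u, v} = {u, w}" using rank_inj that E_edge by (simp add: T_def)
    then show ?thesis by (auto simp: doubleton_eq_iff)
  qed
  then have "timed_graph {..<n} E"
    unfolding timed_graph_def by (auto simp: E_def sym_def irrefl_def)
  moreover have "card E = n * (n - 1)" by (simp add: E_def)
  then have "(n - 1) * card {..<n} \<le> card E" by simp
  moreover have "forces n (n - 1) 0 (s * r ^ k)"
    using forces_iterate[OF n(2) r s, of k] by (rule forces_mono) (use k in auto)
  ultimately obtain v where v: "v < n" "inc_path E 0 v (s * r ^ k) {}"
    using n(1) unfolding forces_def
    by (metis card.empty card_lessThan empty_iff finite.emptyI lessThan_empty_iff lessThan_iff not_numeral_le_zero order_refl bot_nat_def)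
  then obtain vs b where vs: "inc_walk E 0 vs b" "distinct vs" "hd vs = v" "length vs = Suc (s * r ^ k)"
    unfolding inc_path_def by blast
  have "E \<subseteq> {..<n} \<times> {..<n}" by (auto simp: E_def)
  then have "set vs \<subseteq> {..<n}" using inc_walk_verts[OF vs(1)] vs(3) v(1) by auto
  then have "Kn_path n vs" using vs by (auto simp: Kn_path_def)
  moreover have "\<forall>i. Suc i < length (path_edges us) \<longrightarrow> (path_edges us ! i, path_edges us ! Suc i) \<in> R"
    if "inc_walk E t us b" for t us
    using that
  proof (induction us arbitrary: t)
    case (Cons x us)
    show ?case
    proof (cases "length us < 2")
      case True
      then show ?thesis by (cases us) (auto simp: path_edges_def)
    next
      case False
      then obtain y z us' where us: "us = y # z # us'" by (cases us; cases "tl us") auto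
      have pe: "path_edges (x # us) = {x, y} # path_edges us" "path_edges us = {y, z} # path_edges (z # us')"
        by (simp_all add: path_edges_def us)
      have "(x, y) \<in> E" "(y, z) \<in> E" "T x y < T y z" using Cons.prems us by auto
      then have "({x, y}, {y, z}) \<in> R" using E_edge by (intro rank_R) (auto simp: T_def)
      moreover have "inc_walk E (Suc (T x y)) us b" using Cons.prems us by simp
      ultimately show ?thesis using Cons.IH pe
        by (metis Suc_less_eq length_Cons nth_Cons_0 nth_Cons_Suc old.nat.exhaust)
    qed
  qed (simp add: path_edges_def)
  then have "monotone_path R vs" using vs(1) by (auto simp: monotone_path_def Let_def)
  ultimately show ?thesis using vs(4) by (intro exI[of _ vs]) auto
qed

theorem theorem1p1:
  shows "\<exists>C::real. C > 0 \<and> (\<exists>N::nat. \<forall>n \<ge> N. \<forall>R. edge_ordering n R \<longrightarrow>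
     (\<exists>vs. Kn_path n vs \<and> monotone_path R vs \<and>
        real (length vs - 1) \<ge> real n / 2 powr (C * sqrt (log 2 (real n) * log 2 (log 2 (real n))))))"
proof (intro exI[of _ "18::real"] conjI exI[of _ "16::nat"] allI impI)
  fix n :: nat and R assume n: "16 \<le> n" and R: "edge_ordering n R"
  define A where "A = log 2 (real n)"
  define B where "B = log 2 A"
  define S where "S = sqrt (A * B)"
  define q where "q = 2 powr S"
  have powr_A: "2 powr A = n" using n by (simp add: A_def)
  \<comment> \<open>From \<open>16 \<le> n\<close>, both \<open>A\<close> and \<open>q\<close> are
    at least 4; numerical constants are later absorbed by powers of 4.\<close>
  have A4: "4 \<le> A" using n by (simp add: A_def le_log_iff)
  have powr_B: "2 powr B = A" using A4 by (simp add: B_def)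
  have B2: "2 \<le> B" using A4 by (simp add: B_def le_log_iff)
  have "A < 2 powr A"
    unfolding powr_A unfolding A_def using n by (intro log2_of_power_less less_exp) simp
  then have BA: "B \<le> A" using A4 by (simp add: B_def log_le_iff)
  have SS: "S * S = A * B" using A4 B2 by (simp add: S_def)
  have BS: "B \<le> S" unfolding S_def
    using B2 BA by (intro real_le_rsqrt) (simp add: power2_eq_square mult_right_mono)
  have q4: "4 \<le> q"
    using powr_mono[of 2 S 2] BS B2 by (simp add: q_def)
  have Aq: "A \<le> q" using powr_mono[OF BS, of 2] powr_B by (simp add: q_def)
  define J where "J = Suc (nat \<lfloor>A\<rfloor>)"
  define h where "h = Suc J"
  have nJ: "n < 2 ^ J"
  proof -
    have "A < real J" using A4 by (simp add: J_def) linarith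
    then have "2 powr A < 2 powr real J" by simp
    then show ?thesis using powr_A by (simp add: powr_realpow)
  qed
  have h: "1 \<le> h" "real h \<le> 2 * A" using A4 by (auto simp: h_def J_def) linarith
  \<comment> \<open>With a gain of about \<open>q\<close> per round there are at most
    \<open>A / S\<close> rounds. Their losses, powers of \<open>A = 2 powr B\<close>, multiply to a
    power of \<open>2 powr (A * B / S) = q\<close>.\<close>
  define r where "r = nat \<lceil>q\<rceil>"
  have r: "q \<le> real r" "real r \<le> 2 * q" using q4 by (auto simp: r_def) linarith+
  have r1: "1 \<le> r" using r q4 by linarith
  define s where "s = 2 * Suc J * r"
  have s_le: "real s \<le> 8 * q ^ 2"
  proof -
    have "real s = 2 * (real h * real r)" by (simp add: s_def h_def algebra_simps)
    also have "\<dots> \<le> 2 * ((2 * q) * (2 * q))"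
      using h r Aq q4 by (intro mult_left_mono mult_mono) auto
    finally show ?thesis by (simp add: power2_eq_square)
  qed
  have s1: "1 \<le> s" using r1 by (simp add: s_def)
  \<comment> \<open>The average degree required by \<open>k\<close> rounds; the proof stops at a
    \<open>k\<close> with \<open>D k \<le> n - 1 < D (Suc k)\<close>.\<close>
  define D where "D k = 3 * s * (s + 1) * (13 * Suc J * s) ^ k" for k
  have powr_q: "2 powr (18 * S) = q ^ 18" by (simp add: q_def powr_power mult.commute)
  have goal: "\<exists>vs. Kn_path n vs \<and> monotone_path R vs \<and> real n / q ^ 18 \<le> real (length vs - 1)"
  proof (cases "D 0 \<le> n - 1")
    case False
    \<comment> \<open>Here \<open>n\<close> is at most \<open>q ^ 18\<close>, so a single edge is
      long enough.\<close>
    have "real n \<le> real (D 0)" using False n by (intro of_nat_mono) simp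
    also have "real (D 0) \<le> 6 * real s ^ 2"
      using s1 by (simp add: D_def power2_eq_square algebra_simps)
    also have "\<dots> \<le> 6 * (8 * q ^ 2) ^ 2" using s_le by (intro mult_left_mono power_mono) auto
    also have "\<dots> = 384 * q ^ 4" by (simp add: power_mult_distrib)
    also have "\<dots> \<le> 4 ^ 14 * q ^ 4" using q4 by (intro mult_right_mono) auto
    also have "\<dots> \<le> q ^ 14 * q ^ 4" using q4 by (intro mult_right_mono power_mono) auto
    also have "\<dots> = q ^ 18" by (simp flip: power_add)
    finally have "real n / q ^ 18 \<le> 1" using q4 by simp
    moreover have "Kn_path n [0, 1]" "monotone_path R [0, 1]"
      using n by (auto simp: Kn_path_def monotone_path_def path_edges_def)
    ultimately show ?thesis by (intro exI[of _ "[0, 1]"]) auto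
  next
    case True
    have "\<exists>k. D k \<le> n - 1 \<and> \<not> D (Suc k) \<le> n - 1"
    proof (rule ccontr)
      assume "\<not> ?thesis"
      then have "D k \<le> n - 1" for k by (induction k) (use True in auto)
      moreover have "n < D n"
      proof -
        have "2 * 1 \<le> 13 * Suc J * s" using s1 by (intro mult_le_mono) auto
        then have le: "2 ^ n \<le> (13 * Suc J * s) ^ n" by (intro power_mono) auto
        have "n < 2 ^ n" by (rule less_exp)
        also have "\<dots> \<le> (13 * Suc J * s) ^ n" by (rule le)
        also have "\<dots> \<le> D n" using s1 by (simp add: D_def)
        finally show ?thesis .
      qed
      ultimately show False by (metis diff_le_self leD order_trans)
    qed
    then obtain k where k: "D k \<le> n - 1" "\<not> D (Suc k) \<le> n - 1" by blast
    obtain vs where vs: "Kn_path n vs" "monotone_path R vs" "length vs - 1 = s * r ^ k"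
      using Kn_monotone_path[OF R _ nJ r1 s_def, of k] k(1) n unfolding D_def by auto
    have kB: "real k * B \<le> S"
    proof -
      have "r ^ k \<le> (13 * Suc J * s) ^ k"
        by (intro power_mono) (auto simp: s_def algebra_simps)
      also have "\<dots> \<le> D k" using s1 by (simp add: D_def)
      also have "\<dots> \<le> n" using k by simp
      finally have "real r ^ k \<le> real n" by (metis of_nat_mono of_nat_power)
      moreover have "q ^ k \<le> real r ^ k" using r q4 by (intro power_mono) auto
      ultimately have "q ^ k \<le> real n" by linarith
      then have "2 powr (real k * S) \<le> 2 powr A"
        using powr_A by (simp add: q_def powr_power mult.commute)
      then have "real k * S \<le> A" by simp
      then have "real k * S * B \<le> S * S" using B2 SS by (simp add: mult_right_mono)
      then have "(real k * B) * S \<le> S * S" by (simp add: ac_simps)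
      then show ?thesis by (rule mult_right_le_imp_le) (use BS B2 in simp)
    qed
    have pow: "(26 * real h ^ 2) ^ k \<le> q ^ 6"
    proof -
      have "26 * real h ^ 2 \<le> 26 * (2 * A) ^ 2" using h by (intro mult_left_mono power_mono) auto
      also have "\<dots> = 104 * A ^ 2" by (simp add: power_mult_distrib)
      also have "\<dots> \<le> 4 ^ 4 * A ^ 2" by (intro mult_right_mono) auto
      also have "\<dots> \<le> A ^ 4 * A ^ 2" using A4 by (intro mult_right_mono power_mono) auto
      also have "\<dots> = A ^ 6" by (simp flip: power_add)
      finally have "(26 * real h ^ 2) ^ k \<le> (A ^ 6) ^ k" by (intro power_mono) auto
      also have "\<dots> = (A ^ k) ^ 6" by (simp add: mult.commute flip: power_mult)
      also have "A ^ k \<le> q"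
      proof -
        have "A ^ k = 2 powr (real k * B)" unfolding powr_B[symmetric] by (simp add: powr_power mult.commute)
        also have "\<dots> \<le> q" using kB by (simp add: q_def)
        finally show ?thesis .
      qed
      then have "(A ^ k) ^ 6 \<le> q ^ 6" using A4 by (intro power_mono) auto
      finally show ?thesis .
    qed
    \<comment> \<open>The path length \<open>s * r ^ k\<close> is split off from
      \<open>D (Suc k) \<ge> n\<close>. The cofactors are at most \<open>q ^ 5\<close>,
      \<open>q ^ 7\<close> and \<open>q ^ 6\<close>, whence the constant 18.\<close>
    have "D (Suc k) = 3 * (s + 1) * (13 * h * s) * (26 * h ^ 2) ^ k * (s * r ^ k)"
    proof -
      have "13 * h * s = 26 * h ^ 2 * r" by (simp add: s_def h_def power2_eq_square algebra_simps)
      then have "(13 * h * s) ^ k = (26 * h ^ 2) ^ k * r ^ k" by (simp only: power_mult_distrib)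
      then show ?thesis unfolding D_def h_def[symmetric] power_Suc by (simp only: ac_simps)
    qed
    then have "real (D (Suc k)) = 3 * (real s + 1) * (13 * real h * real s) * (26 * real h ^ 2) ^ k * real (s * r ^ k)"
      by simp
    also have "\<dots> \<le> q ^ 5 * q ^ 7 * q ^ 6 * real (s * r ^ k)"
    proof (intro mult_right_mono mult_mono pow)
      have "3 * (real s + 1) \<le> 6 * real s" using s1 by simp
      also have "\<dots> \<le> 4 ^ 3 * q ^ 2" using s_le by simp
      also have "\<dots> \<le> q ^ 3 * q ^ 2" using q4 by (intro mult_right_mono power_mono) auto
      finally show "3 * (real s + 1) \<le> q ^ 5" by (simp flip: power_add)
      have "real h * real s \<le> (2 * q) * (8 * q ^ 2)"
        using h Aq s_le q4 by (intro mult_mono) auto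
      then have "13 * real h * real s \<le> 208 * q ^ 3" by (simp add: power2_eq_square power3_eq_cube)
      also have "\<dots> \<le> 4 ^ 4 * q ^ 3" using q4 by (intro mult_right_mono) auto
      also have "\<dots> \<le> q ^ 4 * q ^ 3" using q4 by (intro mult_right_mono power_mono) auto
      finally show "13 * real h * real s \<le> q ^ 7" by (simp flip: power_add)
    qed (use q4 in auto)
    also have "q ^ 5 * q ^ 7 * q ^ 6 = q ^ 18" by (simp flip: power_add)
    finally have "real (D (Suc k)) \<le> q ^ 18 * real (s * r ^ k)" .
    moreover have "real n \<le> real (D (Suc k))" using k by (intro of_nat_mono) simp
    ultimately have "real n / q ^ 18 \<le> real (s * r ^ k)" using q4 by (simp add: divide_le_eq mult.commute)
    then show ?thesis using vs by (intro exI[of _ vs]) auto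
  qed
  then show "\<exists>vs. Kn_path n vs \<and> monotone_path R vs \<and>
      real n / 2 powr (18 * sqrt (log 2 (real n) * log 2 (log 2 (real n)))) \<le> real (length vs - 1)"
    unfolding A_def[symmetric] B_def[symmetric] S_def[symmetric] powr_q .
qed simp

end
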